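(* Let $\mathcal{G}=(V,E)$ be a finite undirected simple graph with $n=|V|$, and let $k$ be a positive integer. For $i\in V$ let $N(i)=\{j\in V:\{i,j\}\in E\}$. Consider the linear program with variables $u=(u_i)_{i\in V}\in[0,1]^n$ and $x=(x_{ij})_{\{i,j\}\in E}\in[0,1]^{|E|}$ (one variable per edge, so $x_{ij}=x_{ji}$): $$\max_{x,u}\; n-\sum_{i\in V}u_i$$ subject to $$\sum_{j\in N(i)}u_j+k-|N(i)|\;\le\;\sum_{j\in N(i)}x_{ij}+(k-|N(i)|)\,u_i\qquad\forall\, i\in V,$$ $$x_{ij}\le u_i\qquad\forall\, i\in V,\ j\in N(i),$$ $$x_{ij}\le u_j\qquad\forall\, i\in V,\ j\in N(i),$$ $$x_{ij}-u_i-u_j\ge -1\qquad\forall\, i\in V,\ j\in N(i),$$ $$u\in[0,1]^n,\quad x\in[0,1]^{|E|}.$$ Then any optimal solution $(x^*,u^* )$ of this linear program is integer, i.e. all components of $x^*$ and $u^*$ are integers.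
   Context: The linear program in the claim is the continuous relaxation of a binary program (the same objective and constraints, with $u\in\{0,1\}^n$ and $x\in\{0,1\}^{|E|}$) that models the $k$-Core Detection Problem: finding the $k$-core of $\mathcal{G}$, i.e. the maximal induced subgraph of $\mathcal{G}$ in which all nodes have degree at least $k$ (not required to be connected, possibly empty). In the binary program, $u_i=1$ if and only if node $i$ does not belong to the $k$-core, and $x_{ij}$ represents the product $u_iu_j$. *)

theory Defs
  imports Complex_Main
begin

definition finite_simple_graph :: "'a set \<Rightarrow> 'a set set \<Rightarrow> bool" where
  "finite_simple_graph V E \<longleftrightarrow> finite V \<and> (\<forall>e\<in>E. e \<subseteq> V \<and> card e = 2)"

definition nbrs :: "'a set \<Rightarrow> 'a set set \<Rightarrow> 'a \<Rightarrow> 'a set" where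
  "nbrs V E i = {j \<in> V. {i, j} \<in> E}"

(* A point of the linear program is a pair (x, u) with one coordinate x e per edge e and one
   coordinate u i per node i.  Both are total functions; the values of x outside E and of u
   outside V occur neither in the constraints nor in the objective. *)

definition kcore_lp_feasible ::
  "'a set \<Rightarrow> 'a set set \<Rightarrow> nat \<Rightarrow> ('a set \<Rightarrow> real) \<times> ('a \<Rightarrow> real) \<Rightarrow> bool" where
  "kcore_lp_feasible V E k = (\<lambda>(x, u).
     (\<forall>i\<in>V. (\<Sum>j\<in>nbrs V E i. u j) + real k - real (card (nbrs V E i))
        \<le> (\<Sum>j\<in>nbrs V E i. x {i, j}) + (real k - real (card (nbrs V E i))) * u i) \<and>
     (\<forall>i\<in>V. \<forall>j\<in>nbrs V E i. x {i, j} \<le> u i) \<and>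
     (\<forall>i\<in>V. \<forall>j\<in>nbrs V E i. x {i, j} \<le> u j) \<and>
     (\<forall>i\<in>V. \<forall>j\<in>nbrs V E i. x {i, j} - u i - u j \<ge> -1) \<and>
     (\<forall>i\<in>V. 0 \<le> u i \<and> u i \<le> 1) \<and>
     (\<forall>e\<in>E. 0 \<le> x e \<and> x e \<le> 1))"

definition kcore_lp_objective :: "'a set \<Rightarrow> ('a set \<Rightarrow> real) \<times> ('a \<Rightarrow> real) \<Rightarrow> real" where
  "kcore_lp_objective V = (\<lambda>(x, u). real (card V) - (\<Sum>i\<in>V. u i))"

definition kcore_lp_optimal ::
  "'a set \<Rightarrow> 'a set set \<Rightarrow> nat \<Rightarrow> ('a set \<Rightarrow> real) \<times> ('a \<Rightarrow> real) \<Rightarrow> bool" where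
  "kcore_lp_optimal V E k = is_arg_max (kcore_lp_objective V) (kcore_lp_feasible V E k)"

end

theory Submission
  imports Defs
begin

text \<open>
  Put \<open>y i = 1 - u i\<close> and \<open>z i j = 1 - u i - u j + x {i, j}\<close>, the linearisation of
  \<open>y i * y j\<close>. The constraints then say \<open>k * y i \<le> (\<Sum>j. z i j)\<close> over the neighbours \<open>j\<close> of \<open>i\<close>,
  with \<open>0 \<le> z i j \<le> min (y i) (y j)\<close>. If \<open>y i > 0\<close>, each neighbour contributes at most \<open>y i\<close>
  to the right-hand side, and nothing unless \<open>y j > 0\<close>; hence \<open>i\<close> has at least \<open>k\<close> neighbours in the
  support of \<open>y\<close>. The support therefore induces a subgraph of minimum degree at least \<open>k\<close>, and
  raising \<open>y\<close> to \<open>1\<close> on its support keeps it feasible.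

  In the original variables this rounding is the componentwise floor of \<open>(x, u)\<close>
  (lemma \<open>kcore_lp_feasible_floor\<close>). It can only decrease \<open>u\<close>, so at an optimum it must leave \<open>u\<close>
  unchanged: \<open>u\<close> is integer. Finally, at an integer \<open>u\<close> the constraints on an edge leave only the
  value \<open>u i * u j\<close> for its variable.
\<close>

lemma kcore_lp_feasibleD:
  assumes "kcore_lp_feasible V E k (x, u)"
  shows "\<And>i. i \<in> V \<Longrightarrow>
      (\<Sum>j\<in>nbrs V E i. u j) + real k - real (card (nbrs V E i))
        \<le> (\<Sum>j\<in>nbrs V E i. x {i, j}) + (real k - real (card (nbrs V E i))) * u i"
    and "\<And>i j. i \<in> V \<Longrightarrow> j \<in> nbrs V E i \<Longrightarrow> x {i, j} \<le> u i"
    and "\<And>i j. i \<in> V \<Longrightarrow> j \<in> nbrs V E i \<Longrightarrow> x {i, j} \<le> u j"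
    and "\<And>i j. i \<in> V \<Longrightarrow> j \<in> nbrs V E i \<Longrightarrow> u i + u j - 1 \<le> x {i, j}"
    and "\<And>i. i \<in> V \<Longrightarrow> 0 \<le> u i \<and> u i \<le> 1"
    and "\<And>e. e \<in> E \<Longrightarrow> 0 \<le> x e \<and> x e \<le> 1"
  using assms unfolding kcore_lp_feasible_def by (auto simp: algebra_simps)

lemma floor_unit_interval:
  fixes t :: real
  assumes "0 \<le> t" "t \<le> 1"
  shows "real_of_int \<lfloor>t\<rfloor> = (if t = 1 then 1 else 0)"
proof (cases "t = 1")
  case False
  with assms have "\<lfloor>t\<rfloor> = 0" by (simp add: floor_eq_iff)
  with False show ?thesis by simp
qed simp

text \<open>
  The edge constraints survive the floor because it is monotone and superadditive. The degree
  constraint is the graph-theoretic part. At a node with \<open>u i < 1\<close>, each term \<open>u j - x {i, j}\<close> is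
  nonnegative, and at least \<open>1 - u i\<close> if \<open>u j = 1\<close>; dividing the constraint by \<open>1 - u i\<close> then
  shows that at most \<open>card (nbrs V E i) - k\<close> neighbours have \<open>u j = 1\<close>.
\<close>

lemma kcore_lp_feasible_floor:
  assumes feas: "kcore_lp_feasible V E k (x, u)"
  shows "kcore_lp_feasible V E k (\<lambda>e. real_of_int \<lfloor>x e\<rfloor>, \<lambda>i. real_of_int \<lfloor>u i\<rfloor>)"
proof -
  note F = kcore_lp_feasibleD[OF feas]
  have degree: "(\<Sum>j\<in>nbrs V E i. real_of_int \<lfloor>u j\<rfloor>) + real k - real (card (nbrs V E i))
      \<le> (\<Sum>j\<in>nbrs V E i. real_of_int \<lfloor>x {i, j}\<rfloor>)
         + (real k - real (card (nbrs V E i))) * real_of_int \<lfloor>u i\<rfloor>"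
    if i: "i \<in> V" for i
  proof (cases "u i = 1")
    case True
    have "x {i, j} = u j" if "j \<in> nbrs V E i" for j
      using F(3,4)[OF i that] True by simp
    then have "(\<Sum>j\<in>nbrs V E i. real_of_int \<lfloor>u j\<rfloor>) = (\<Sum>j\<in>nbrs V E i. real_of_int \<lfloor>x {i, j}\<rfloor>)"
      by simp
    with True show ?thesis by simp
  next
    case False
    with F(5)[OF i] have pos: "0 < 1 - u i" and floor_ui: "real_of_int \<lfloor>u i\<rfloor> = 0"
      by (simp_all add: floor_unit_interval)
    have "(1 - u i) * (\<Sum>j\<in>nbrs V E i. real_of_int \<lfloor>u j\<rfloor>) \<le> (\<Sum>j\<in>nbrs V E i. u j - x {i, j})"
      unfolding sum_distrib_left
    proof (rule sum_mono)
      fix j assume j: "j \<in> nbrs V E i"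
      then have "j \<in> V" by (simp add: nbrs_def)
      then show "(1 - u i) * real_of_int \<lfloor>u j\<rfloor> \<le> u j - x {i, j}"
        using F(2,3)[OF i j] F(5)[of j] by (simp add: floor_unit_interval)
    qed
    also have "\<dots> \<le> (1 - u i) * (real (card (nbrs V E i)) - real k)"
      using F(1)[OF i] by (simp add: sum_subtractf algebra_simps)
    finally have "(\<Sum>j\<in>nbrs V E i. real_of_int \<lfloor>u j\<rfloor>) \<le> real (card (nbrs V E i)) - real k"
      using pos by (simp only: mult_le_cancel_left_pos)
    moreover have "0 \<le> (\<Sum>j\<in>nbrs V E i. real_of_int \<lfloor>x {i, j}\<rfloor>)"
      using F(6) by (intro sum_nonneg) (simp add: nbrs_def)
    ultimately show ?thesis using floor_ui by simp
  qed
  have linearisation: "real_of_int \<lfloor>x {i, j}\<rfloor> - real_of_int \<lfloor>u i\<rfloor> - real_of_int \<lfloor>u j\<rfloor> \<ge> -1"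
    if "i \<in> V" "j \<in> nbrs V E i" for i j
  proof -
    have "real_of_int (\<lfloor>u i\<rfloor> + \<lfloor>u j\<rfloor> - 1) \<le> x {i, j}"
      using F(4)[OF that] of_int_floor_le[of "u i"] of_int_floor_le[of "u j"]
      unfolding of_int_add of_int_diff of_int_1 by linarith
    then have "\<lfloor>u i\<rfloor> + \<lfloor>u j\<rfloor> - 1 \<le> \<lfloor>x {i, j}\<rfloor>" by (simp only: le_floor_iff)
    then show ?thesis by linarith
  qed
  have "real_of_int \<lfloor>x {i, j}\<rfloor> \<le> real_of_int \<lfloor>u i\<rfloor> \<and> real_of_int \<lfloor>x {i, j}\<rfloor> \<le> real_of_int \<lfloor>u j\<rfloor>"
    if "i \<in> V" "j \<in> nbrs V E i" for i j
    using F(2,3)[OF that] by (simp add: floor_mono)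
  moreover have "0 \<le> real_of_int \<lfloor>u i\<rfloor> \<and> real_of_int \<lfloor>u i\<rfloor> \<le> 1" if "i \<in> V" for i
    using F(5)[OF that] by (simp add: floor_unit_interval)
  moreover have "0 \<le> real_of_int \<lfloor>x e\<rfloor> \<and> real_of_int \<lfloor>x e\<rfloor> \<le> 1" if "e \<in> E" for e
    using F(6)[OF that] by (simp add: floor_unit_interval)
  ultimately show ?thesis
    using degree linearisation unfolding kcore_lp_feasible_def by blast
qed

lemma kcore_lp_optimal_node_integral:
  assumes "finite V" and opt: "kcore_lp_optimal V E k (x, u)" and "i \<in> V"
  shows "u i \<in> \<int>"
proof -
  have feas: "kcore_lp_feasible V E k (x, u)"
    and best: "\<And>q. kcore_lp_feasible V E k q \<Longrightarrow>
        kcore_lp_objective V q \<le> kcore_lp_objective V (x, u)"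
    using opt by (auto simp: kcore_lp_optimal_def is_arg_max_linorder)
  have "(\<Sum>i\<in>V. u i) \<le> (\<Sum>i\<in>V. real_of_int \<lfloor>u i\<rfloor>)"
    using best[OF kcore_lp_feasible_floor[OF feas]] by (simp add: kcore_lp_objective_def)
  then have "(\<Sum>i\<in>V. real_of_int \<lfloor>u i\<rfloor>) = (\<Sum>i\<in>V. u i)"
    by (simp add: antisym sum_mono)
  \<comment> \<open>Equal sums of termwise ordered families agree termwise.\<close>
  then have "real_of_int \<lfloor>u i\<rfloor> = u i"
    by (rule sum_mono_inv[OF _ _ \<open>i \<in> V\<close> \<open>finite V\<close>]) simp
  then show ?thesis by (metis Ints_of_int)
qed

lemma kcore_lp_feasible_edge_eq_product:
  assumes feas: "kcore_lp_feasible V E k (x, u)"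
    and "i \<in> V" "j \<in> nbrs V E i" "u i \<in> \<int>" "u j \<in> \<int>"
  shows "x {i, j} = u i * u j"
proof -
  note F = kcore_lp_feasibleD[OF feas]
  have "j \<in> V" and "{i, j} \<in> E" using \<open>j \<in> nbrs V E i\<close> by (simp_all add: nbrs_def)
  have "u l \<in> {0, 1}" if "l \<in> V" "u l \<in> \<int>" for l
    using F(5)[OF \<open>l \<in> V\<close>] floor_unit_interval[of "u l"] \<open>u l \<in> \<int>\<close>
    by (auto elim!: Ints_cases split: if_splits)
  then have "u i \<in> {0, 1}" "u j \<in> {0, 1}" using assms \<open>j \<in> V\<close> by blast+
  then show ?thesis
    using F(2-4)[OF \<open>i \<in> V\<close> \<open>j \<in> nbrs V E i\<close>] F(6)[OF \<open>{i, j} \<in> E\<close>] by auto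
qed

theorem theorem1:
  fixes V :: "'a set" and E :: "'a set set" and k :: nat
    and x :: "'a set \<Rightarrow> real" and u :: "'a \<Rightarrow> real"
  assumes "finite_simple_graph V E"
    and "k > 0"
    and "kcore_lp_optimal V E k (x, u)"
  shows "(\<forall>e\<in>E. x e \<in> \<int>) \<and> (\<forall>i\<in>V. u i \<in> \<int>)"
proof -
  have "finite V" using assms(1) by (simp add: finite_simple_graph_def)
  then have nodes: "u i \<in> \<int>" if "i \<in> V" for i
    using assms(3) that by (rule kcore_lp_optimal_node_integral)
  have feas: "kcore_lp_feasible V E k (x, u)"
    using assms(3) by (simp add: kcore_lp_optimal_def is_arg_max_def)
  have "x e \<in> \<int>" if "e \<in> E" for e
  proof -
    have "e \<subseteq> V" "card e = 2" using assms(1) that by (auto simp: finite_simple_graph_def)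
    then obtain i j where e: "e = {i, j}" and "i \<in> V" "j \<in> V"
      by (auto simp: card_2_iff)
    then have "x e = u i * u j"
      using kcore_lp_feasible_edge_eq_product[OF feas \<open>i \<in> V\<close>, of j] nodes that
      by (simp add: nbrs_def)
    then show ?thesis using nodes \<open>i \<in> V\<close> \<open>j \<in> V\<close> by simp
  qed
  with nodes show ?thesis by blast
qed

end
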